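(* Let $U=\begin{pmatrix} a & b\\ c & d\end{pmatrix}$ be a $2\times 2$ unitary matrix with $abcd\neq 0$ and let $\varphi={}^t[\alpha,\beta]\in\mathbf{C}^2$ with $|\alpha|^2+|\beta|^2=1$. Then as $n\to\infty$, $X_n^{\varphi}/n$ converges in distribution to a random variable $Z^{\varphi}$ having density $$f(x;{}^t[\alpha,\beta])=\frac{\sqrt{1-|a|^2}}{\pi(1-x^2)\sqrt{|a|^2-x^2}}\left\{1-\left(|\alpha|^2-|\beta|^2+\frac{a\alpha\overline{b\beta}+\overline{a\alpha}b\beta}{|a|^2}\right)x\right\}$$ for $x\in(-|a|,|a|)$ (and $0$ elsewhere). Moreover $$E(Z^{\varphi})=-\left(|\alpha|^2-|\beta|^2+\frac{a\alpha\overline{b\beta}+\overline{a\alpha}b\beta}{|a|^2}\right)\left(1-\sqrt{1-|a|^2}\right),\qquad E\big((Z^{\varphi})^2\big)=1-\sqrt{1-|a|^2}.$$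
   Context: Quantum random walk on $\mathbf{Z}$ determined by a $2\times2$ unitary matrix $U=\begin{pmatrix} a & b\\ c & d\end{pmatrix}$: set $P=\begin{pmatrix} a & b\\ 0&0\end{pmatrix}$, $Q=\begin{pmatrix} 0&0\\ c & d\end{pmatrix}$. Given an initial qubit state $\varphi={}^t[\alpha,\beta]\in\mathbf{C}^2$ with $|\alpha|^2+|\beta|^2=1$, define amplitudes $\Psi_k(n)\in\mathbf{C}^2$ ($k\in\mathbf{Z}$, $n\ge0$) by $\Psi_0(0)=\varphi$, $\Psi_k(0)=0$ for $k\neq0$, and $\Psi_k(n+1)=P\Psi_{k+1}(n)+Q\Psi_{k-1}(n)$. The random variable $X_n^{\varphi}$ takes value $k$ with probability $\|\Psi_k(n)\|^2$. $\overline{z}$ denotes complex conjugate. *)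

theory Defs
  imports "HOL-Probability.Probability"
begin

text \<open>Unitarity of U = [[a,b],[c,d]], written out: U^* U = I.\<close>
definition unitary2 :: "complex \<Rightarrow> complex \<Rightarrow> complex \<Rightarrow> complex \<Rightarrow> bool" where
  "unitary2 a b c d \<longleftrightarrow>
     cnj a * a + cnj c * c = 1 \<and> cnj b * b + cnj d * d = 1 \<and> cnj a * b + cnj c * d = 0"

text \<open>Amplitude Psi_k(n) in C^2 as a pair; P = [[a,b],[0,0]], Q = [[0,0],[c,d]].\<close>
fun qw_amp :: "complex \<Rightarrow> complex \<Rightarrow> complex \<Rightarrow> complex \<Rightarrow> complex \<Rightarrow> complex
               \<Rightarrow> nat \<Rightarrow> int \<Rightarrow> complex \<times> complex" where
  "qw_amp a b c d \<alpha> \<beta> 0 k = (if k = 0 then (\<alpha>, \<beta>) else (0, 0))"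
| "qw_amp a b c d \<alpha> \<beta> (Suc n) k =
     (a * fst (qw_amp a b c d \<alpha> \<beta> n (k + 1)) + b * snd (qw_amp a b c d \<alpha> \<beta> n (k + 1)),
      c * fst (qw_amp a b c d \<alpha> \<beta> n (k - 1)) + d * snd (qw_amp a b c d \<alpha> \<beta> n (k - 1)))"

definition qw_prob :: "complex \<Rightarrow> complex \<Rightarrow> complex \<Rightarrow> complex \<Rightarrow> complex \<Rightarrow> complex
               \<Rightarrow> nat \<Rightarrow> int \<Rightarrow> real" where
  "qw_prob a b c d \<alpha> \<beta> n k =
     (cmod (fst (qw_amp a b c d \<alpha> \<beta> n k)))\<^sup>2 + (cmod (snd (qw_amp a b c d \<alpha> \<beta> n k)))\<^sup>2"

definition qw_scaled_law :: "complex \<Rightarrow> complex \<Rightarrow> complex \<Rightarrow> complex \<Rightarrow> complex \<Rightarrow> complex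
               \<Rightarrow> nat \<Rightarrow> real measure" where
  "qw_scaled_law a b c d \<alpha> \<beta> n =
     distr (density (count_space UNIV) (\<lambda>k. ennreal (qw_prob a b c d \<alpha> \<beta> n k)))
           borel (\<lambda>k. real_of_int k / real n)"

definition qw_coef :: "complex \<Rightarrow> complex \<Rightarrow> complex \<Rightarrow> complex \<Rightarrow> real" where
  "qw_coef a b \<alpha> \<beta> =
     (cmod \<alpha>)\<^sup>2 - (cmod \<beta>)\<^sup>2
     + Re ((a * \<alpha> * cnj (b * \<beta>) + cnj (a * \<alpha>) * b * \<beta>) / complex_of_real ((cmod a)\<^sup>2))"

definition qw_density :: "complex \<Rightarrow> complex \<Rightarrow> complex \<Rightarrow> complex \<Rightarrow> real \<Rightarrow> real" where
  "qw_density a b \<alpha> \<beta> x =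
     (if - cmod a < x \<and> x < cmod a then
        sqrt (1 - (cmod a)\<^sup>2) / (pi * (1 - x\<^sup>2) * sqrt ((cmod a)\<^sup>2 - x\<^sup>2))
        * (1 - qw_coef a b \<alpha> \<beta> * x)
      else 0)"

end

theory Submission
  imports Defs
begin

text \<open>
  Write \<open>r = |a|\<close>. After removing a phase and shifting the momentum, one step of the walk in Fourier space
  is a matrix in SU(2) with trace \<open>2 r cos u\<close>, that is \<open>cos \<theta> + J sin \<theta>\<close> with
  \<open>cos \<theta>(u) = r cos u\<close>, \<open>J\<close> skew-Hermitian and \<open>J\<^sup>2 = -1\<close>; hence its n-th power is
  \<open>cos n\<theta> + J sin n\<theta>\<close>, without any diagonalization. By Parseval the characteristic function of
  \<open>X_n / n\<close> at \<open>t\<close> is the mean over \<open>u\<close> of the inner product of the states with momenta \<open>u\<close> and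
  \<open>u + t/n\<close>. It converges pointwise, since \<open>n (\<theta>(u + t/n) - \<theta>(u))\<close> tends to \<open>t h(u)\<close> with the group
  velocity \<open>h = \<theta>'\<close>, and dominated convergence yields the mean of \<open>(1 - C h(u)) exp (i t h(u))\<close>
  over \<open>[-pi/2, pi/2]\<close>. The substitution \<open>x = h(u)\<close> turns this into the characteristic function of the
  stated density, and Levy's continuity theorem concludes.
\<close>

section \<open>Group velocity, its inverse, and the substitution
  \<open>x = group_velocity r u\<close>\<close>

definition group_velocity :: "real \<Rightarrow> real \<Rightarrow> real" where
  "group_velocity r u = r * sin u / sqrt (1 - (r * cos u)\<^sup>2)"

text \<open>The stated density without its factor \<open>1 - C * x\<close> and before the cutoff to
  the open interval.\<close>

definition konno_density :: "real \<Rightarrow> real \<Rightarrow> real" where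
  "konno_density r x = sqrt (1 - r\<^sup>2) / (pi * (1 - x\<^sup>2) * sqrt (r\<^sup>2 - x\<^sup>2))"

text \<open>Solving \<open>x = group_velocity r u\<close> for \<open>s = sin u\<close>: squaring
  gives \<open>x^2 * (1 - r^2 + r^2 * s^2) = r^2 * s^2\<close>, hence
  \<open>s^2 = x^2 * (1 - r^2) / (r^2 * (1 - x^2))\<close>, and \<open>s\<close> has the sign of
  \<open>x\<close>.\<close>

definition konno_angle :: "real \<Rightarrow> real \<Rightarrow> real" where
  "konno_angle r x = arcsin (x * sqrt (1 - r\<^sup>2) / (r * sqrt (1 - x\<^sup>2)))"

text \<open>Here \<open>y\<close> is the sine of \<open>konno_angle r x\<close>. The last identity
  is its squared cosine; it is nonnegative exactly because \<open>x^2\<close> is at most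
  \<open>r^2\<close>, and this keeps \<open>y\<close> in the domain of
  \<open>arcsin\<close>.\<close>

lemma konno_sin_bounds:
  fixes r x :: real
  assumes r: "0 < r" "r < 1" and x: "\<bar>x\<bar> \<le> r"
  defines "y \<equiv> x * sqrt (1 - r\<^sup>2) / (r * sqrt (1 - x\<^sup>2))"
  shows "x\<^sup>2 < 1" "r\<^sup>2 < 1" "y\<^sup>2 \<le> 1" "-1 \<le> y" "y \<le> 1"
    and "1 - y\<^sup>2 = (r\<^sup>2 - x\<^sup>2) / (r\<^sup>2 * (1 - x\<^sup>2))"
proof -
  show x2: "x\<^sup>2 < 1" using r x by (auto simp: abs_square_less_1)
  show r2: "r\<^sup>2 < 1" using r by (auto simp: abs_square_less_1)
  have xr: "x\<^sup>2 \<le> r\<^sup>2" using x r by (metis abs_le_square_iff abs_of_pos)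
  have "y\<^sup>2 = x\<^sup>2 * (1 - r\<^sup>2) / (r\<^sup>2 * (1 - x\<^sup>2))"
    using x2 r2 by (simp add: y_def power_divide power_mult_distrib)
  then show e: "1 - y\<^sup>2 = (r\<^sup>2 - x\<^sup>2) / (r\<^sup>2 * (1 - x\<^sup>2))"
    using r x2 by (simp add: field_simps)
  have "0 \<le> 1 - y\<^sup>2" unfolding e using xr x2 r by simp
  then show y2: "y\<^sup>2 \<le> 1" by simp
  then show "-1 \<le> y" "y \<le> 1" by (auto simp: abs_square_le_1 abs_le_iff)
qed

lemma continuous_on_group_velocity:
  assumes r: "0 < r" "r < 1"
  shows "continuous_on UNIV (group_velocity r)"
proof -
  have pos: "0 < 1 - (r * cos u)\<^sup>2" for u
  proof -
    have "\<bar>r * cos u\<bar> \<le> r * 1" unfolding abs_mult using r by (intro mult_mono) auto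
    then show ?thesis using r abs_square_less_1[of "r * cos u"] by auto
  qed
  then show ?thesis
    unfolding group_velocity_def by (intro continuous_intros) (auto simp: less_imp_neq[symmetric])
qed

lemma group_velocity_konno_angle:
  assumes r: "0 < r" "r < 1" and x: "\<bar>x\<bar> \<le> r"
  shows "group_velocity r (konno_angle r x) = x"
proof -
  define y where "y = x * sqrt (1 - r\<^sup>2) / (r * sqrt (1 - x\<^sup>2))"
  note b = konno_sin_bounds[OF r x, folded y_def]
  have "1 - (r * cos (arcsin y))\<^sup>2 = 1 - r\<^sup>2 * (1 - y\<^sup>2)"
    using b by (simp add: power_mult_distrib cos_arcsin)
  also have "\<dots> = (1 - r\<^sup>2) / (1 - x\<^sup>2)"
    unfolding b(6) using b(1) r by (simp add: field_simps)
  finally have c: "1 - (r * cos (arcsin y))\<^sup>2 = (1 - r\<^sup>2) / (1 - x\<^sup>2)" .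
  have "sqrt (1 - x\<^sup>2) > 0" "sqrt (1 - r\<^sup>2) > 0" using b by auto
  then show ?thesis
    unfolding group_velocity_def konno_angle_def y_def[symmetric] c
    using b r by (simp add: real_sqrt_divide) (simp add: y_def field_simps)
qed

lemma continuous_on_konno_angle:
  assumes r: "0 < r" "r < 1"
  shows "continuous_on {-r..r} (konno_angle r)"
proof -
  have "sqrt (1 - x\<^sup>2) \<noteq> 0" if "x \<in> {-r..r}" for x
    using konno_sin_bounds(1)[OF r, of x] that by (auto simp: abs_le_iff)
  moreover have "\<bar>x\<bar> \<le> r" if "x \<in> {-r..r}" for x using that by (auto simp: abs_le_iff)
  ultimately show ?thesis unfolding konno_angle_def
    using r konno_sin_bounds(4,5)[OF r] by (intro continuous_intros ballI conjI) auto
qed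

lemma konno_angle_ends:
  assumes r: "0 < r" "r < 1"
  shows "konno_angle r r = pi / 2" "konno_angle r (- r) = - (pi / 2)"
proof -
  have "sqrt (1 - r\<^sup>2) \<noteq> 0" using konno_sin_bounds(2)[OF r, of r] r by simp
  then show "konno_angle r r = pi / 2" "konno_angle r (- r) = - (pi / 2)"
    using r by (auto simp: konno_angle_def)
qed

text \<open>The Jacobian of the substitution. The endpoints are excluded because there
  \<open>y\<close> reaches 1 or -1, where \<open>arcsin\<close> has no finite derivative.\<close>

lemma DERIV_konno_angle:
  assumes r: "0 < r" "r < 1" and x: "\<bar>x\<bar> < r"
  shows "(konno_angle r has_real_derivative pi * konno_density r x) (at x)"
proof -
  define y where "y = x * sqrt (1 - r\<^sup>2) / (r * sqrt (1 - x\<^sup>2))"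
  have "\<bar>x\<bar> \<le> r" using x by simp
  note b = konno_sin_bounds[OF r this, folded y_def]
  have xr: "x\<^sup>2 < r\<^sup>2" using x r
    by (metis abs_ge_zero power2_abs power_strict_mono zero_less_numeral)
  define X where "X = sqrt (1 - x\<^sup>2)"
  define Z where "Z = sqrt (r\<^sup>2 - x\<^sup>2)"
  have X: "X > 0" "X\<^sup>2 = 1 - x\<^sup>2" and Z: "Z > 0" using b xr by (auto simp: X_def Z_def)
  have s: "sqrt (1 - y\<^sup>2) = Z / (r * X)"
    unfolding b(6) using r by (simp add: real_sqrt_divide real_sqrt_mult X_def Z_def)
  have "0 < 1 - y\<^sup>2" unfolding b(6) using xr b r by simp
  then have y1: "-1 < y" "y < 1" using abs_square_less_1[of y] by auto
  have "((\<lambda>x. x * sqrt (1 - r\<^sup>2) / (r * sqrt (1 - x\<^sup>2))) has_real_derivative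
      sqrt (1 - r\<^sup>2) / (r * X ^ 3)) (at x)"
  proof -
    let ?s = "sqrt (1 - r\<^sup>2)"
    have D: "((\<lambda>x. sqrt (1 - x\<^sup>2)) has_real_derivative - x / X) (at x)"
      using b(1) by (auto intro!: derivative_eq_intros simp: X_def field_simps)
    have nz: "r * X \<noteq> 0" using X r by simp
    have "((\<lambda>x. x * ?s / (r * sqrt (1 - x\<^sup>2))) has_real_derivative
        (1 * ?s * (r * X) - x * ?s * (r * (- x / X))) / ((r * X) * (r * X))) (at x)"
      using DERIV_divide[OF DERIV_cmult_right[OF DERIV_ident, of ?s] DERIV_cmult[OF D, of r],
          folded X_def] nz by blast
    also have "(1 * ?s * (r * X) - x * ?s * (r * (- x / X))) / ((r * X) * (r * X))
        = ?s * (X\<^sup>2 + x\<^sup>2) / (r * X ^ 3)"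
      using X(1) r by (simp add: field_simps power2_eq_square power3_eq_cube)
    finally show ?thesis by (simp add: X(2))
  qed
  from DERIV_chain'[OF this DERIV_arcsin[OF y1, unfolded y_def]]
  have "(konno_angle r has_real_derivative
      inverse (sqrt (1 - y\<^sup>2)) * (sqrt (1 - r\<^sup>2) / (r * X ^ 3))) (at x)"
    unfolding konno_angle_def y_def .
  also have "inverse (sqrt (1 - y\<^sup>2)) * (sqrt (1 - r\<^sup>2) / (r * X ^ 3)) = pi * konno_density r x"
    unfolding konno_density_def s X(2)[symmetric] Z_def[symmetric]
    using X(1) Z r by (simp add: field_simps power3_eq_cube power2_eq_square)
  finally show ?thesis .
qed

text \<open>Substitution \<open>u = konno_angle r x\<close>, with the two singular endpoints as
  exceptional set. The integrand is vector valued so that the same statement serves the total mass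
  (\<open>H = 1\<close>) and the characteristic function (complex \<open>H\<close>).\<close>

lemma has_integral_konno_density:
  fixes H :: "real \<Rightarrow> 'a::euclidean_space"
  assumes r: "0 < r" "r < 1" and H: "continuous_on UNIV H"
  shows "((\<lambda>x. (pi * konno_density r x) *\<^sub>R H x) has_integral
           integral {-(pi/2)..pi/2} (\<lambda>u. H (group_velocity r u))) {-r..r}"
proof -
  note cv = continuous_on_group_velocity[OF r]
  have "((\<lambda>x. (pi * konno_density r x) *\<^sub>R (\<lambda>u. H (group_velocity r u)) (konno_angle r x)) has_integral
           integral {konno_angle r (-r)..konno_angle r r} (\<lambda>u. H (group_velocity r u))) {-r..r}"
  proof (rule has_integral_substitution_strong[where s = "{-r, r}" and c = "-(pi/2)" and d = "pi/2"])
    show "konno_angle r ` {-r..r} \<subseteq> {- (pi / 2)..pi / 2}"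
    proof
      fix z assume "z \<in> konno_angle r ` {-r..r}"
      then obtain x where "x \<in> {-r..r}" and z: "z = konno_angle r x" by blast
      then have x: "\<bar>x\<bar> \<le> r" by auto
      show "z \<in> {- (pi / 2)..pi / 2}"
        unfolding z konno_angle_def using arcsin_bounded[OF konno_sin_bounds(4,5)[OF r x]] by auto
    qed
    show "continuous_on {- (pi / 2)..pi / 2} (\<lambda>u. H (group_velocity r u))"
      by (rule continuous_on_compose2[OF H continuous_on_subset[OF cv]]) auto
    show "(konno_angle r has_real_derivative pi * konno_density r x) (at x within {-r..r})"
      if "x \<in> {-r..r} - {-r,r}" for x
    proof -
      have "\<bar>x\<bar> < r" using that by auto
      then show ?thesis by (rule has_field_derivative_at_within[OF DERIV_konno_angle[OF r]])
    qed
  qed (use r konno_angle_ends[OF r] pi_ge_zero continuous_on_konno_angle[OF r] in \<open>auto simp del: pi_ge_zero\<close>)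
  then show ?thesis
    unfolding konno_angle_ends[OF r]
  proof (rule has_integral_eq[rotated])
    fix x assume "x \<in> {-r..r}"
    then have "\<bar>x\<bar> \<le> r" by auto
    then show "(pi * konno_density r x) *\<^sub>R H (group_velocity r (konno_angle r x)) =
        (pi * konno_density r x) *\<^sub>R H x"
      by (simp only: group_velocity_konno_angle[OF r])
  qed
qed

section \<open>Lebesgue integrals and moments of the symmetric density\<close>

definition konno_pdf :: "real \<Rightarrow> real \<Rightarrow> real" where
  "konno_pdf r x = indicator {-r<..<r} x * konno_density r x"

lemma konno_pdf_measurable [measurable]: "konno_pdf r \<in> borel_measurable borel"
  unfolding konno_pdf_def konno_density_def by measurable

text \<open>The cutoff in \<open>konno_pdf\<close> matters here: \<open>sqrt\<close> of a negative
  number is negative, so \<open>konno_density r x\<close> is negative when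
  \<open>\<bar>x\<bar>\<close> lies strictly between \<open>r\<close> and 1.\<close>

lemma konno_pdf_nonneg:
  assumes r: "0 < r" "r < 1"
  shows "0 \<le> konno_pdf r x"
proof (cases "\<bar>x\<bar> < r")
  case True
  have "x\<^sup>2 \<le> r\<^sup>2" using True r by (metis abs_le_square_iff abs_of_pos less_imp_le)
  then show ?thesis using konno_sin_bounds(1,2)[OF r, of x] True
    by (simp add: konno_pdf_def konno_density_def)
qed (auto simp: konno_pdf_def indicator_def)

text \<open>Transfers gauge integrals, as produced by substitution and antiderivatives, to Lebesgue
  integrals. Nonnegativity of the integrand is what permits this, by way of the nonnegative
  integral; the endpoints form a null set.\<close>

lemma has_bochner_integral_konno_pdf_times:
  assumes r: "0 < r" "r < 1" and p [measurable]: "p \<in> borel_measurable borel" and p0: "\<And>x. 0 \<le> p x"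
    and I: "((\<lambda>x. p x * konno_density r x) has_integral I) {-r..r}"
  shows "has_bochner_integral lborel (\<lambda>x. p x * konno_pdf r x) I"
proof -
  have eq: "p x * konno_pdf r x = p x * konno_density r x" if "x \<in> {-r..r} - {-r,r}" for x
    using that by (auto simp: konno_pdf_def indicator_def)
  have J: "((\<lambda>x. p x * konno_pdf r x) has_integral I) {-r..r}"
    by (rule has_integral_spike_finite[OF _ _ I, of "{-r,r}"]) (use eq in auto)
  have "I \<ge> 0" by (rule has_integral_nonneg[OF J]) (simp add: p0 konno_pdf_nonneg r)
  have "integral\<^sup>N lborel (\<lambda>x. indicator {-r..r} x * (p x * konno_pdf r x)) = I"
    by (rule nn_integral_has_integral_lebesgue[OF _ J]) (simp add: p0 konno_pdf_nonneg r)
  moreover have "indicator {-r..r} x * (p x * konno_pdf r x) = p x * konno_pdf r x" for x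
    by (auto simp: konno_pdf_def indicator_def)
  ultimately have "(\<integral>\<^sup>+x. ennreal (p x * konno_pdf r x) \<partial>lborel) = ennreal I" by simp
  then show ?thesis
    by (intro has_bochner_integral_nn_integral) (use \<open>I \<ge> 0\<close> p0 konno_pdf_nonneg[OF r] in auto)
qed

lemma has_bochner_integral_konno_pdf:
  assumes r: "0 < r" "r < 1"
  shows "has_bochner_integral lborel (konno_pdf r) 1"
proof -
  have "((\<lambda>x. pi * konno_density r x) has_integral pi) {-r..r}"
    using has_integral_konno_density[OF r, of "\<lambda>_. 1::real"] by simp
  from has_integral_mult_right[OF this, of "1/pi"]
  have "((\<lambda>x. 1 * konno_density r x) has_integral 1) {-r..r}" by simp
  from has_bochner_integral_konno_pdf_times[OF r _ _ this] show ?thesis by simp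
qed

text \<open>Since \<open>x^2 / (1 - x^2) = 1 / (1 - x^2) - 1\<close>, the integrand is
  \<open>konno_density r x\<close> minus \<open>sqrt (1 - r^2)\<close> times the arcsine density
  \<open>1 / (pi * sqrt (r^2 - x^2))\<close>. This explains the antiderivative \<open>?F\<close>;
  both densities have mass 1. \<open>?F\<close> is continuous up to the endpoints but is
  differentiated only inside.\<close>

lemma has_bochner_integral_konno_pdf_square:
  assumes r: "0 < r" "r < 1"
  shows "has_bochner_integral lborel (\<lambda>x. x\<^sup>2 * konno_pdf r x) (1 - sqrt (1 - r\<^sup>2))"
proof (rule has_bochner_integral_konno_pdf_times[OF r])
  let ?F = "\<lambda>x. (konno_angle r x - sqrt (1 - r\<^sup>2) * arcsin (x / r)) / pi"
  have "((\<lambda>x. x\<^sup>2 * konno_density r x) has_integral ?F r - ?F (-r)) {-r..r}"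
  proof (rule fundamental_theorem_of_calculus_interior)
    show "continuous_on {-r..r} ?F"
      using r by (intro continuous_intros continuous_on_konno_angle) (auto simp: field_simps)
    fix x assume "x \<in> {-r<..<r}"
    then have x: "\<bar>x\<bar> < r" by auto
    have xr: "x\<^sup>2 < r\<^sup>2" using x r
      by (metis abs_ge_zero power2_abs power_strict_mono zero_less_numeral)
    have x1: "x\<^sup>2 < 1" using konno_sin_bounds(1)[OF r, of x] x by simp
    define Z where "Z = sqrt (r\<^sup>2 - x\<^sup>2)"
    have Z: "Z > 0" using xr by (simp add: Z_def)
    have "sqrt (1 - (x/r)\<^sup>2) = sqrt ((r\<^sup>2 - x\<^sup>2) / r\<^sup>2)" using r by (simp add: field_simps)
    also have "\<dots> = Z / r" using r by (simp add: real_sqrt_divide Z_def)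
    finally have s: "sqrt (1 - (x/r)\<^sup>2) = Z / r" .
    have "((\<lambda>x. arcsin (x / r)) has_real_derivative inverse (sqrt (1 - (x/r)\<^sup>2)) * (1 / r)) (at x)"
      using x r by (intro DERIV_chain2[OF DERIV_arcsin]) (auto intro!: derivative_eq_intros simp: field_simps)
    then have d: "((\<lambda>x. arcsin (x / r)) has_real_derivative 1 / Z) (at x)"
      using r by (simp add: s)
    have "(?F has_real_derivative (pi * konno_density r x - sqrt (1 - r\<^sup>2) * (1 / Z)) / pi) (at x)"
      by (intro DERIV_cdivide DERIV_diff DERIV_konno_angle r x DERIV_cmult d)
    also have "(pi * konno_density r x - sqrt (1 - r\<^sup>2) * (1 / Z)) / pi = x\<^sup>2 * konno_density r x"
      unfolding konno_density_def Z_def[symmetric] using x1 Z by (simp add: field_simps)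
    finally show "(?F has_vector_derivative x\<^sup>2 * konno_density r x) (at x)"
      by (simp add: has_real_derivative_iff_has_vector_derivative)
  qed (use r in auto)
  moreover have "?F r - ?F (-r) = 1 - sqrt (1 - r\<^sup>2)"
    using r konno_angle_ends[OF r] by (simp add: field_simps)
  ultimately show "((\<lambda>x. x\<^sup>2 * konno_density r x) has_integral 1 - sqrt (1 - r\<^sup>2)) {-r..r}" by simp
qed auto

lemma integrable_konno_pdf_bounded:
  fixes g :: "real \<Rightarrow> 'a::{banach, second_countable_topology}"
  assumes r: "0 < r" "r < 1" and g [measurable]: "g \<in> borel_measurable borel"
    and b: "\<And>x. \<bar>x\<bar> < r \<Longrightarrow> norm (g x) \<le> B"
  shows "integrable lborel (\<lambda>x. konno_pdf r x *\<^sub>R g x)"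
proof (rule Bochner_Integration.integrable_bound)
  show "integrable lborel (\<lambda>x. B * konno_pdf r x)"
    using has_bochner_integral_konno_pdf[OF r] by (intro integrable_mult_right) (auto simp: has_bochner_integral_iff)
  have "norm (konno_pdf r x *\<^sub>R g x) \<le> norm (B * konno_pdf r x)" for x
  proof (cases "\<bar>x\<bar> < r")
    case True
    have "norm (g x) \<le> \<bar>B\<bar>" using b[OF True] by linarith
    then show ?thesis by (simp add: abs_mult mult.commute mult_right_mono)
  qed (auto simp: konno_pdf_def indicator_def)
  then show "AE x in lborel. norm (konno_pdf r x *\<^sub>R g x) \<le> norm (B * konno_pdf r x)" by simp
qed measurable

text \<open>Symmetry makes the two halves cancel once the positive half is known to be integrable;
  that follows from \<open>\<bar>x\<bar> ^ k \<le> 1\<close> on the support.\<close>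

lemma has_bochner_integral_konno_pdf_odd:
  assumes r: "0 < r" "r < 1" and k: "odd k"
  shows "has_bochner_integral lborel (\<lambda>x. x ^ k * konno_pdf r x) 0"
proof -
  have "integrable lborel (\<lambda>x. konno_pdf r x *\<^sub>R (indicator {0..} x *\<^sub>R x ^ k))"
  proof (rule integrable_konno_pdf_bounded[OF r, where B = 1])
    fix x :: real assume "\<bar>x\<bar> < r"
    then have "\<bar>x\<bar> ^ k \<le> 1" using r by (intro power_le_one) auto
    then show "norm (indicator {0..} x *\<^sub>R x ^ k) \<le> 1"
      by (cases "0 \<le> x") (simp_all only: indicator_simps atLeast_iff, simp_all)
  qed measurable
  then have "integrable lborel (\<lambda>x. indicator {0..} x *\<^sub>R (x ^ k * konno_pdf r x))"
    by (simp add: mult_ac)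
  from has_bochner_integral_integrable[OF this] show ?thesis
    by (rule has_bochner_integral_odd_function)
       (use k in \<open>simp add: konno_pdf_def konno_density_def indicator_def less_minus_iff minus_less_iff conj_commute\<close>)
qed

section \<open>Trigonometric polynomials: orthogonality, Parseval and shifts\<close>

lemma complex_of_real_cmod_square: "(complex_of_real (cmod z))\<^sup>2 = z * cnj z"
  by (simp add: complex_norm_square flip: of_real_power)

text \<open>The base point \<open>p\<close> stays free so that the period can later start at
  \<open>-(pi/2)\<close>, where it suits the reflection symmetry of the integrand.\<close>

lemma has_integral_cis_period:
  fixes p :: real and m :: int
  shows "((\<lambda>u. cis (of_int m * u)) has_integral (if m = 0 then 2 * pi else 0)) {p..p + 2 * pi}"
proof (cases "m = 0")
  case True
  then show ?thesis using has_integral_const_real[of "1::complex" p "p + 2 * pi"] by (simp add: scaleR_conv_of_real)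
next
  case False
  let ?F = "\<lambda>u. cis (of_int m * u) / (\<i> * of_int m)"
  have "((\<lambda>u. cis (of_int m * u)) has_integral ?F (p + 2 * pi) - ?F p) {p..p + 2 * pi}"
  proof (rule fundamental_theorem_of_calculus)
    fix x
    have "((\<lambda>u. cis (of_int m * u)) has_vector_derivative of_int m *\<^sub>R (\<i> * cis (of_int m * x)))
        (at x within {p..p + 2 * pi})"
      unfolding has_vector_derivative_def by (auto intro!: derivative_eq_intros)
    from has_vector_derivative_divide[OF this, of "\<i> * of_int m"] False
    show "(?F has_vector_derivative cis (of_int m * x)) (at x within {p..p + 2 * pi})"
      by (simp add: scaleR_conv_of_real)
  qed simp
  moreover have "cis (of_int m * (p + 2 * pi)) = cis (of_int m * p)"
    using cis_multiple_2pi[of "of_int m"]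
    by (simp add: distrib_left cis_mult[symmetric] mult.commute mult.left_commute)
  ultimately show ?thesis using False by simp
qed

text \<open>Orthogonality leaves only the diagonal of the double sum. The shift by \<open>s\<close>
  in the second factor multiplies the k-th diagonal term by \<open>cis (k * s)\<close>, which turns
  Parseval's identity into a formula for the characteristic function of the weights
  \<open>(cmod (f k))^2\<close>.\<close>

lemma parseval_trigonometric_polynomial:
  fixes f :: "int \<Rightarrow> complex" and p s :: real
  assumes K: "finite K"
  shows "((\<lambda>u. cnj (\<Sum>k\<in>K. cis (of_int k * u) * f k) * (\<Sum>k\<in>K. cis (of_int k * (u + s)) * f k))
    has_integral 2 * pi * (\<Sum>k\<in>K. (cmod (f k))\<^sup>2 * cis (of_int k * s))) {p..p + 2 * pi}"
proof -
  have "((\<lambda>u. \<Sum>j\<in>K. \<Sum>k\<in>K. cnj (f j) * f k * cis (of_int k * s) * cis (of_int (k - j) * u)) has_integral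
      (\<Sum>j\<in>K. \<Sum>k\<in>K. cnj (f j) * f k * cis (of_int k * s) * (if k - j = 0 then 2 * pi else 0))) {p..p + 2 * pi}"
    by (intro has_integral_sum K has_integral_mult_right has_integral_cis_period)
  also have "(\<lambda>u. \<Sum>j\<in>K. \<Sum>k\<in>K. cnj (f j) * f k * cis (of_int k * s) * cis (of_int (k - j) * u)) =
     (\<lambda>u. cnj (\<Sum>k\<in>K. cis (of_int k * u) * f k) * (\<Sum>k\<in>K. cis (of_int k * (u + s)) * f k))"
  proof (rule ext)
    fix u
    have c: "cis (of_int (k - j) * u) = cnj (cis (of_int j * u)) * cis (of_int k * u)"
      "cis (of_int k * (u + s)) = cis (of_int k * u) * cis (of_int k * s)" for j k :: int
      by (simp_all add: cis_cnj cis_mult algebra_simps)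
    show "(\<Sum>j\<in>K. \<Sum>k\<in>K. cnj (f j) * f k * cis (of_int k * s) * cis (of_int (k - j) * u)) =
      cnj (\<Sum>k\<in>K. cis (of_int k * u) * f k) * (\<Sum>k\<in>K. cis (of_int k * (u + s)) * f k)"
      unfolding cnj_sum sum_product c by (intro sum.cong refl) (simp only: complex_cnj_mult mult_ac)
  qed
  also have "(\<Sum>j\<in>K. \<Sum>k\<in>K. cnj (f j) * f k * cis (of_int k * s) * (if k - j = 0 then 2 * pi else 0)) =
     2 * pi * (\<Sum>k\<in>K. (cmod (f k))\<^sup>2 * cis (of_int k * s))"
  proof -
    have "(\<Sum>k\<in>K. cnj (f j) * f k * cis (of_int k * s) * (if k - j = 0 then 2 * pi else 0)) =
        2 * pi * ((cmod (f j))\<^sup>2 * cis (of_int j * s))" if "j \<in> K" for j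
    proof -
      have "(\<Sum>k\<in>K. cnj (f j) * f k * cis (of_int k * s) * (if k - j = 0 then 2 * pi else 0)) =
        (\<Sum>k\<in>K. if j = k then 2 * pi * (f k * cnj (f k)) * cis (of_int k * s) else 0)"
        by (intro sum.cong) auto
      also have "\<dots> = 2 * pi * (f j * cnj (f j)) * cis (of_int j * s)" using K that by (simp add: sum.delta')
      finally show ?thesis by (simp only: of_real_power complex_of_real_cmod_square mult.assoc)
    qed
    then show ?thesis by (simp add: sum_distrib_left)
  qed
  finally show ?thesis .
qed

text \<open>Both index sets need only contain the relevant support. This allows passing from the
  range at time \<open>n\<close> to the wider one at time \<open>n + 1\<close>.\<close>

lemma trigonometric_sum_shift:
  fixes f :: "int \<Rightarrow> complex"
  assumes "finite A" "finite B" "\<And>k. k \<notin> A \<Longrightarrow> f k = 0" "\<And>k. k \<notin> B \<Longrightarrow> f (k + s) = 0"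
  shows "(\<Sum>k\<in>B. cis (of_int k * x) * f (k + s)) = cis (- of_int s * x) * (\<Sum>k\<in>A. cis (of_int k * x) * f k)"
  unfolding sum_distrib_left
proof (rule sum.reindex_bij_witness_not_neutral[where S' = "{k\<in>B. f (k + s) = 0}" and T' = "{k\<in>A. f k = 0}"
    and i = "\<lambda>k. k - s" and j = "\<lambda>k. k + s"])
  show "k + s \<in> A - {k \<in> A. f k = 0}" if "k \<in> B - {k \<in> B. f (k + s) = 0}" for k
    using that assms(3) by auto
  show "k - s \<in> B - {k \<in> B. f (k + s) = 0}" if "k \<in> A - {k \<in> A. f k = 0}" for k
    using that assms(4)[of "k - s"] by auto
  show "cis (- of_int s * x) * (cis (of_int (k + s) * x) * f (k + s)) = cis (of_int k * x) * f (k + s)" for k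
  proof -
    have "cis (- of_int s * x) * cis (of_int (k + s) * x) = cis (of_int k * x)"
      by (simp add: cis_mult algebra_simps)
    then show ?thesis by (simp only: mult.assoc[symmetric])
  qed
qed (use assms in auto)

section \<open>The normalized one-step matrix in Fourier space and its powers\<close>

abbreviation rcos :: "real \<Rightarrow> complex" where "rcos x \<equiv> complex_of_real (cos x)"

abbreviation rsin :: "real \<Rightarrow> complex" where "rsin x \<equiv> complex_of_real (sin x)"

text \<open>The one-step matrix M at momentum \<open>u\<close> has rows
  \<open>(r * cis (-u), q * cis (-u))\<close> and \<open>(- cnj q * cis u, r * cis u)\<close>; the
  assumption \<open>q\<close> says that its determinant is 1. In the application
  \<open>r = cmod a\<close> and \<open>q = cmod a * b / a\<close>.\<close>

locale coin =
  fixes r :: real and q \<alpha> \<beta> :: complex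
  assumes r: "0 < r" "r < 1" and q: "r\<^sup>2 + (cmod q)\<^sup>2 = 1"
    and state: "(cmod \<alpha>)\<^sup>2 + (cmod \<beta>)\<^sup>2 = 1"
begin

definition ang :: "real \<Rightarrow> real" where "ang u = arccos (r * cos u)"

definition sin_ang :: "real \<Rightarrow> real" where "sin_ang u = sqrt (1 - (r * cos u)\<^sup>2)"

text \<open>The pair \<open>(v1 u, v2 u)\<close> is \<open>J (\<alpha>, \<beta>)\<close>.\<close>

definition v1 :: "real \<Rightarrow> complex" where
  "v1 u = (- \<i> * r * rsin u * \<alpha> + q * cis (- u) * \<beta>) / sin_ang u"

definition v2 :: "real \<Rightarrow> complex" where
  "v2 u = (- cnj q * cis u * \<alpha> + \<i> * r * rsin u * \<beta>) / sin_ang u"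

definition psi1 :: "nat \<Rightarrow> real \<Rightarrow> complex" where
  "psi1 n u = rcos (n * ang u) * \<alpha> + rsin (n * ang u) * v1 u"

definition psi2 :: "nat \<Rightarrow> real \<Rightarrow> complex" where
  "psi2 n u = rcos (n * ang u) * \<beta> + rsin (n * ang u) * v2 u"

lemma abs_r_cos: "\<bar>r * cos u\<bar> < 1"
proof -
  have "\<bar>r * cos u\<bar> \<le> r * 1" unfolding abs_mult using r by (intro mult_mono) auto
  then show ?thesis using r by linarith
qed

lemma sin_ang_pos: "0 < sin_ang u"
  using abs_r_cos[of u] by (simp add: sin_ang_def abs_square_less_1)

lemma sin_ang_square: "(sin_ang u)\<^sup>2 = 1 - (r * cos u)\<^sup>2"
  using abs_r_cos[of u] by (simp add: sin_ang_def abs_square_less_1 less_imp_le)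

lemma sin_ang: "sin (ang u) = sin_ang u"
  using abs_r_cos[of u] by (simp add: sin_ang_def ang_def sin_arccos_abs)

lemma cos_ang: "cos (ang u) = r * cos u"
  using abs_r_cos[of u] by (simp add: ang_def cos_arccos_abs)

lemma q_cnj: "complex_of_real r * r + q * cnj q = 1"
  using arg_cong[OF q, of complex_of_real]
  unfolding of_real_add of_real_power complex_of_real_cmod_square by (simp add: power2_eq_square)

lemma state_cnj: "\<alpha> * cnj \<alpha> + \<beta> * cnj \<beta> = 1"
  using arg_cong[OF state, of complex_of_real]
  unfolding of_real_add of_real_power complex_of_real_cmod_square by simp

lemma v_times:
  "sin_ang u * v1 u = - \<i> * r * rsin u * \<alpha> + q * cis (- u) * \<beta>"
  "sin_ang u * v2 u = - cnj q * cis u * \<alpha> + \<i> * r * rsin u * \<beta>"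
  using sin_ang_pos[of u] by (simp_all add: v1_def v2_def)

lemma complex_trig:
  "rcos u * rcos u + rsin u * rsin u = 1"
  "complex_of_real (sin_ang u) * sin_ang u + r * rcos u * (r * rcos u) = 1"
  "complex_of_real (sin_ang u) \<noteq> 0"
  "cis u = rcos u + \<i> * rsin u" "cis (-u) = rcos u - \<i> * rsin u"
proof -
  show "rcos u * rcos u + rsin u * rsin u = 1" unfolding of_real_mult[symmetric] of_real_add[symmetric]
    by (simp flip: power2_eq_square)
  show "complex_of_real (sin_ang u) * sin_ang u + r * rcos u * (r * rcos u) = 1"
    unfolding of_real_mult[symmetric] of_real_add[symmetric]
    using sin_ang_square[of u] by (simp flip: power2_eq_square)
  show "complex_of_real (sin_ang u) \<noteq> 0" using sin_ang_pos[of u] by simp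
  show "cis u = rcos u + \<i> * rsin u" "cis (-u) = rcos u - \<i> * rsin u" by (auto simp: complex_eq_iff)
qed

text \<open>First row of \<open>M J phi = cos theta * J phi - sin theta * phi\<close> for the state
  \<open>phi\<close>, which is how the relation \<open>J^2 = -1\<close> enters.\<close>

lemma coin_step_v1: "r * cis (- u) * v1 u + q * cis (- u) * v2 u = r * rcos u * v1 u - sin_ang u * \<alpha>"
proof -
  note t = complex_trig[of u]
  have i: "\<i> * \<i> = -1" by simp
  \<comment> \<open>Multiplying by \<open>sin_ang u\<close> clears the denominators of
    \<open>v1\<close> and \<open>v2\<close>; a polynomial identity modulo the trigonometric
    relations and \<open>q_cnj\<close> remains.\<close>
  have "sin_ang u * (r * cis (- u) * v1 u + q * cis (- u) * v2 u)
      = sin_ang u * (r * rcos u * v1 u - sin_ang u * \<alpha>)"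
    using v_times[of u] t(1,2) q_cnj i unfolding t(4,5) of_real_mult by algebra
  then show ?thesis using t(3) by simp
qed

lemma coin_step_v2: "- cnj q * cis u * v1 u + r * cis u * v2 u = r * rcos u * v2 u - sin_ang u * \<beta>"
proof -
  note t = complex_trig[of u]
  have i: "\<i> * \<i> = -1" by simp
  have "sin_ang u * (- cnj q * cis u * v1 u + r * cis u * v2 u)
      = sin_ang u * (r * rcos u * v2 u - sin_ang u * \<beta>)"
    using v_times[of u] t(1,2) q_cnj i unfolding t(4,5) of_real_mult by algebra
  then show ?thesis using t(3) by simp
qed

lemma coin_step_state:
  "r * cis (- u) * \<alpha> + q * cis (- u) * \<beta> = r * rcos u * \<alpha> + sin_ang u * v1 u"
  "- cnj q * cis u * \<alpha> + r * cis u * \<beta> = r * rcos u * \<beta> + sin_ang u * v2 u"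
  unfolding v_times complex_trig(4,5) by (simp_all add: algebra_simps)

text \<open>By the \<open>coin_step\<close> lemmas M acts on \<open>phi\<close> and
  \<open>J phi\<close> like a rotation by \<open>ang u\<close>, so the addition formulas advance the
  angle from \<open>n * ang u\<close> to \<open>Suc n * ang u\<close>.\<close>

lemma psi_Suc:
  "r * cis (- u) * psi1 n u + q * cis (- u) * psi2 n u = psi1 (Suc n) u"
  "- cnj q * cis u * psi1 n u + r * cis u * psi2 n u = psi2 (Suc n) u"
proof -
  define C where "C = complex_of_real (cos (n * ang u))"
  define D where "D = complex_of_real (sin (n * ang u))"
  have e: "real (Suc n) * ang u = n * ang u + ang u" by (simp add: algebra_simps)
  have c: "complex_of_real (cos (Suc n * ang u)) = C * (r * rcos u) - D * sin_ang u"
    "complex_of_real (sin (Suc n * ang u)) = D * (r * rcos u) + C * sin_ang u"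
    unfolding e cos_add sin_add sin_ang cos_ang C_def D_def by simp_all
  show "r * cis (- u) * psi1 n u + q * cis (- u) * psi2 n u = psi1 (Suc n) u"
    unfolding psi1_def psi2_def c C_def[symmetric] D_def[symmetric]
    using coin_step_v1[of u] coin_step_state(1)[of u] unfolding of_real_mult by algebra
  show "- cnj q * cis u * psi1 n u + r * cis u * psi2 n u = psi2 (Suc n) u"
    unfolding psi1_def psi2_def c C_def[symmetric] D_def[symmetric]
    using coin_step_v2[of u] coin_step_state(2)[of u] unfolding of_real_mult by algebra
qed

lemma v_norm: "cnj (v1 u) * v1 u + cnj (v2 u) * v2 u = 1"
proof -
  note t = complex_trig[of u]
  have i: "\<i> * \<i> = -1" by simp
  have c: "sin_ang u * cnj (v1 u) = \<i> * r * rsin u * cnj \<alpha> + cnj q * cis u * cnj \<beta>"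
    "sin_ang u * cnj (v2 u) = - q * cis (-u) * cnj \<alpha> - \<i> * r * rsin u * cnj \<beta>"
    using arg_cong[OF v_times(1)[of u], of cnj] arg_cong[OF v_times(2)[of u], of cnj]
    by (simp_all add: cis_cnj flip: cis_inverse)
  have "sin_ang u * sin_ang u * (cnj (v1 u) * v1 u + cnj (v2 u) * v2 u)
      = sin_ang u * sin_ang u * (\<alpha> * cnj \<alpha> + \<beta> * cnj \<beta>)"
    using v_times[of u] c t(1,2) q_cnj i unfolding t(4,5) of_real_mult by algebra
  then show ?thesis using t(3) by (simp add: state_cnj)
qed

text \<open>The coefficient \<open>qw_coef\<close> rewritten in terms of \<open>r\<close> and
  \<open>q\<close>; the two are identified inside \<open>theorem3\<close>.\<close>

definition coef :: real where
  "coef = (cmod \<alpha>)\<^sup>2 - (cmod \<beta>)\<^sup>2 + 2 * Re (cnj \<alpha> * \<beta> * q) / r"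

definition skew :: "real \<Rightarrow> real" where
  "skew u = - coef * group_velocity r u + 2 * Im (cnj \<alpha> * \<beta> * q) * cos u / sin_ang u"

text \<open>J is skew-Hermitian, so the inner product of the state with its image under J is purely
  imaginary, and \<open>skew\<close> is its imaginary part. The terms in \<open>sin u\<close>
  combine to the group velocity with factor \<open>- coef\<close>.\<close>

lemma state_v: "cnj \<alpha> * v1 u + cnj \<beta> * v2 u = \<i> * skew u"
proof -
  define k where "k = cnj \<alpha> * \<beta> * q"
  have kc: "\<alpha> * cnj \<beta> * cnj q = cnj k" by (simp add: k_def)
  have ka: "complex_of_real ((cmod \<alpha>)\<^sup>2) = \<alpha> * cnj \<alpha>" "complex_of_real ((cmod \<beta>)\<^sup>2) = \<beta> * cnj \<beta>"
    by (simp_all add: complex_of_real_cmod_square)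
  note t = complex_trig[of u]
  have "sin_ang u * skew u = - (r * ((cmod \<alpha>)\<^sup>2 - (cmod \<beta>)\<^sup>2) + 2 * Re k) * sin u + 2 * Im k * cos u"
    unfolding skew_def coef_def group_velocity_def sin_ang_def[of u, symmetric] k_def[symmetric]
    using sin_ang_pos[of u] r by (simp add: field_simps)
  then have s: "complex_of_real (sin_ang u) * skew u =
      - (r * (\<alpha> * cnj \<alpha> - \<beta> * cnj \<beta>) + (k + cnj k)) * rsin u + 2 * Im k * rcos u"
    unfolding of_real_mult[symmetric]
    by (simp add: ka[symmetric] complex_add_cnj)
  have d: "2 * \<i> * Im k = k - cnj k" by (simp add: complex_diff_cnj)
  have "sin_ang u * (cnj \<alpha> * v1 u + cnj \<beta> * v2 u) = cnj \<alpha> * (sin_ang u * v1 u) + cnj \<beta> * (sin_ang u * v2 u)"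
    by (simp add: algebra_simps)
  also have "\<dots> = - \<i> * r * rsin u * (\<alpha> * cnj \<alpha> - \<beta> * cnj \<beta>) + k * cis (- u) - cnj k * cis u"
    unfolding v_times kc[symmetric] unfolding k_def by (simp add: algebra_simps)
  also have "\<dots> = - \<i> * r * rsin u * (\<alpha> * cnj \<alpha> - \<beta> * cnj \<beta>) - \<i> * rsin u * (k + cnj k) + (k - cnj k) * rcos u"
    unfolding t(4,5) by (simp add: algebra_simps)
  also have "\<dots> = \<i> * (complex_of_real (sin_ang u) * skew u)"
    unfolding s d[symmetric] by (simp add: algebra_simps)
  finally have "sin_ang u * (cnj \<alpha> * v1 u + cnj \<beta> * v2 u) = sin_ang u * (\<i> * skew u)"
    by (simp add: mult_ac)
  then show ?thesis using t(3) by simp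
qed

section \<open>Inner products of the states at two momenta and their limit\<close>

definition overlap :: "nat \<Rightarrow> real \<Rightarrow> real \<Rightarrow> complex" where
  "overlap n u w = cnj (psi1 n u) * psi1 n w + cnj (psi2 n u) * psi2 n w"

text \<open>The mixed terms are evaluated by \<open>state_v\<close> and its conjugate; the product
  of cosines has factor 1 because the initial state is normalized.\<close>

lemma overlap_eq:
  "overlap n u w = rcos (n * ang u) * rcos (n * ang w)
     + rsin (n * ang u) * rsin (n * ang w) * (cnj (v1 u) * v1 w + cnj (v2 u) * v2 w)
     + rcos (n * ang u) * rsin (n * ang w) * (\<i> * skew w)
     - rsin (n * ang u) * rcos (n * ang w) * (\<i> * skew u)"
proof -
  have c: "cnj (v1 u) * \<alpha> + cnj (v2 u) * \<beta> = - (\<i> * skew u)"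
    using arg_cong[OF state_v[of u], of cnj] by (simp add: mult.commute)
  show ?thesis
    unfolding overlap_def psi1_def psi2_def complex_cnj_add complex_cnj_mult complex_cnj_complex_of_real of_real_mult
    using c state_v[of w] state_cnj by algebra
qed

text \<open>Normalization of the evolved state: at equal momenta the mixed terms cancel. It yields
  the bounds \<open>norm_psi\<close> and the total probability \<open>sum_qw_prob\<close>.\<close>

lemma overlap_self: "overlap n u u = 1"
proof -
  have "overlap n u u = complex_of_real ((cos (n * ang u))\<^sup>2 + (sin (n * ang u))\<^sup>2)"
    unfolding overlap_eq v_norm of_real_add of_real_power power2_eq_square by (simp add: mult_ac)
  then show ?thesis by (simp only: sin_cos_squared_add2 of_real_1)
qed

lemma DERIV_ang: "(ang has_real_derivative group_velocity r u) (at u)"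
proof -
  have b: "-1 < r * cos u" "r * cos u < 1" using abs_r_cos[of u] by auto
  have "((\<lambda>u. r * cos u) has_real_derivative r * - sin u) (at u)"
    by (intro DERIV_cmult DERIV_cos)
  from DERIV_chain'[OF this DERIV_arccos[OF b]] show ?thesis
    unfolding ang_def group_velocity_def by (simp add: divide_inverse mult.commute)
qed

lemma cont_sin_ang: "continuous_on UNIV sin_ang"
  unfolding sin_ang_def by (intro continuous_intros)

lemma cont_v: "continuous_on UNIV v1" "continuous_on UNIV v2"
  unfolding v1_def v2_def using sin_ang_pos
  by (intro continuous_intros continuous_on_compose2[OF cont_sin_ang]; simp add: less_imp_neq[symmetric])+

lemma cont_skew: "continuous_on UNIV skew"
  unfolding skew_def using sin_ang_pos
  by (intro continuous_intros continuous_on_compose2[OF cont_sin_ang] continuous_on_compose2[OF continuous_on_group_velocity[OF r]];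
      simp add: less_imp_neq[symmetric])

lemma cont_ang: "continuous_on UNIV ang"
  using DERIV_ang by (intro continuous_at_imp_continuous_on ballI DERIV_isCont)

lemma cont_psi: "continuous_on UNIV (psi1 n)" "continuous_on UNIV (psi2 n)"
  unfolding psi1_def psi2_def
  by (intro continuous_intros continuous_on_compose2[OF cont_ang] cont_v; simp)+

lemma norm_psi: "cmod (psi1 n u) \<le> 1" "cmod (psi2 n u) \<le> 1"
proof -
  have "complex_of_real ((cmod (psi1 n u))\<^sup>2 + (cmod (psi2 n u))\<^sup>2) = 1"
    using overlap_self[of n u] by (simp add: overlap_def complex_of_real_cmod_square mult.commute)
  then have "(cmod (psi1 n u))\<^sup>2 + (cmod (psi2 n u))\<^sup>2 = 1" by (simp only: of_real_eq_1_iff)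
  then have "(cmod (psi1 n u))\<^sup>2 \<le> 1" "(cmod (psi2 n u))\<^sup>2 \<le> 1"
    using zero_le_power2[of "cmod (psi1 n u)"] zero_le_power2[of "cmod (psi2 n u)"] by linarith+
  then show "cmod (psi1 n u) \<le> 1" "cmod (psi2 n u) \<le> 1"
    by (simp_all add: abs_square_le_1)
qed

text \<open>A crude bound, uniform in \<open>n\<close>, that serves as the dominating
  constant.\<close>

lemma norm_overlap: "cmod (overlap n u w) \<le> 2"
proof -
  have "cmod (overlap n u w) \<le> cmod (psi1 n u) * cmod (psi1 n w) + cmod (psi2 n u) * cmod (psi2 n w)"
    unfolding overlap_def by (rule order_trans[OF norm_triangle_ineq]) (simp add: norm_mult)
  also have "\<dots> \<le> 1 * 1 + 1 * 1" by (intro add_mono mult_mono norm_psi) auto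
  finally show ?thesis by simp
qed

text \<open>This is \<open>t\<close> times a difference quotient of \<open>ang\<close> with step
  \<open>t / n\<close>; for \<open>t = 0\<close> the step vanishes, hence the case
  distinction.\<close>

lemma ang_increment: "(\<lambda>n. real n * (ang (u + t / real n) - ang u)) \<longlonglongrightarrow> t * group_velocity r u"
proof (cases "t = 0")
  case False
  have "(\<lambda>n. t / real n) \<longlonglongrightarrow> 0" by (rule lim_const_over_n)
  moreover have "\<forall>\<^sub>F n in sequentially. t / real n \<noteq> 0"
    using eventually_gt_at_top[of 0] by eventually_elim (use False in auto)
  ultimately have f: "filterlim (\<lambda>n. t / real n) (at 0) sequentially" by (simp add: filterlim_at)
  have "(\<lambda>n. t * ((ang (u + t / real n) - ang u) / (t / real n))) \<longlonglongrightarrow> t * group_velocity r u"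
    by (intro tendsto_intros filterlim_compose[OF DERIV_ang[of u, unfolded DERIV_def] f])
  then show ?thesis using False by (simp add: divide_simps mult.commute)
qed simp

text \<open>The phases \<open>n * ang u\<close> need not converge, but their difference at
  \<open>u\<close> and \<open>w n\<close> does. Replacing \<open>v1\<close>, \<open>v2\<close> and
  \<open>skew\<close> at \<open>w n\<close> by their values at \<open>u\<close> makes
  \<open>overlap_eq\<close> collapse, by the addition formulas, to a function of that difference.
  The error \<open>E\<close> consists of bounded trigonometric factors times null sequences.\<close>

lemma overlap_limit:
  "(\<lambda>n. overlap n u (u + t / real n)) \<longlonglongrightarrow>
     rcos (t * group_velocity r u) + \<i> * skew u * rsin (t * group_velocity r u)"
proof -
  define w where "w n = u + t / real n" for n :: nat
  have w: "w \<longlonglongrightarrow> u" unfolding w_def using tendsto_add[OF tendsto_const lim_const_over_n] by fastforce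
  have c: "(\<lambda>n. f (w n)) \<longlonglongrightarrow> f u" if "continuous_on UNIV f" for f :: "real \<Rightarrow> 'b::topological_space"
    using that w by (metis continuous_on_eq_continuous_at isCont_tendsto_compose open_UNIV UNIV_I)
  define E where "E n = rsin (n * ang u) * rsin (n * ang (w n)) * (cnj (v1 u) * v1 (w n) + cnj (v2 u) * v2 (w n) - 1)
     + rcos (n * ang u) * rsin (n * ang (w n)) * (\<i> * (complex_of_real (skew (w n)) - skew u))" for n
  have bz: "(\<lambda>n. complex_of_real (g n * h n) * z n) \<longlonglongrightarrow> 0"
    if z: "z \<longlonglongrightarrow> 0" and g: "\<And>n. \<bar>g n\<bar> \<le> 1" and h: "\<And>n. \<bar>h n\<bar> \<le> 1" for g h :: "nat \<Rightarrow> real" and z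
  proof (rule Lim_null_comparison[OF _ tendsto_norm_zero[OF z]])
    have "\<bar>g n * h n\<bar> * norm (z n) \<le> 1 * norm (z n)" for n
      unfolding abs_mult by (intro mult_right_mono mult_le_one g h) auto
    then show "\<forall>\<^sub>F n in sequentially. norm (complex_of_real (g n * h n) * z n) \<le> norm (z n)"
      unfolding norm_mult norm_of_real by simp
  qed
  have "(\<lambda>n. cnj (v1 u) * v1 (w n) + cnj (v2 u) * v2 (w n) - 1)
      \<longlonglongrightarrow> cnj (v1 u) * v1 u + cnj (v2 u) * v2 u - 1"
    by (intro tendsto_intros c cont_v)
  then have z1: "(\<lambda>n. cnj (v1 u) * v1 (w n) + cnj (v2 u) * v2 (w n) - 1) \<longlonglongrightarrow> 0"
    by (simp only: v_norm diff_self)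
  have "(\<lambda>n. \<i> * (complex_of_real (skew (w n)) - skew u)) \<longlonglongrightarrow> \<i> * (complex_of_real (skew u) - skew u)"
    by (intro tendsto_intros c cont_skew)
  then have z2: "(\<lambda>n. \<i> * (complex_of_real (skew (w n)) - skew u)) \<longlonglongrightarrow> 0" by simp
  have E0: "E \<longlonglongrightarrow> 0"
    unfolding E_def using tendsto_add[OF bz[OF z1] bz[OF z2]] by (simp add: mult.assoc)
  have "isCont (\<lambda>x. rcos x + \<i> * skew u * rsin x) (t * group_velocity r u)"
    by (intro continuous_intros)
  from isCont_tendsto_compose[OF this ang_increment[of u t]]
  have L: "(\<lambda>n. rcos (n * (ang (w n) - ang u)) + \<i> * skew u * rsin (n * (ang (w n) - ang u)))
     \<longlonglongrightarrow> rcos (t * group_velocity r u) + \<i> * skew u * rsin (t * group_velocity r u)"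
    unfolding w_def .
  have "overlap n u (w n) =
      rcos (n * (ang (w n) - ang u)) + \<i> * skew u * rsin (n * (ang (w n) - ang u)) + E n" for n
    unfolding overlap_eq E_def right_diff_distrib[of "real n"] cos_diff sin_diff
    by (simp add: algebra_simps)
  then show ?thesis
    using tendsto_add[OF L E0] by (simp only: w_def add_0_right)
qed

end

section \<open>The amplitudes of the walk in Fourier space\<close>

lemma qw_amp_outside: "int n < \<bar>k\<bar> \<Longrightarrow> qw_amp a b c d \<alpha> \<beta> n k = (0, 0)"
  by (induction n arbitrary: k) auto

lemma qw_prob_outside: "int n < \<bar>k\<bar> \<Longrightarrow> qw_prob a b c d \<alpha> \<beta> n k = 0"
  by (simp add: qw_prob_def qw_amp_outside)

context coin
begin

text \<open>A lattice shift multiplies the transform by \<open>cis\<close> of plus or minus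
  \<open>u + \<xi>\<close>. The part with \<open>\<xi>\<close> cancels against the factors
  \<open>cis \<xi>\<close> and \<open>cis (- \<xi>)\<close> of the coin, leaving one step of
  \<open>psi_Suc\<close> and one factor \<open>\<delta>\<close>.\<close>

lemma qw_amp_fourier:
  fixes a b c d \<delta> :: complex and \<xi> :: real and n :: nat
  assumes U: "a = \<delta> * r * cis \<xi>" "b = \<delta> * q * cis \<xi>" "c = - \<delta> * cnj q * cis (- \<xi>)" "d = \<delta> * r * cis (- \<xi>)"
  shows "(\<Sum>k\<in>{-int n..int n}. cis (of_int k * (u + \<xi>)) * fst (qw_amp a b c d \<alpha> \<beta> n k)) = \<delta> ^ n * psi1 n u \<and>
    (\<Sum>k\<in>{-int n..int n}. cis (of_int k * (u + \<xi>)) * snd (qw_amp a b c d \<alpha> \<beta> n k)) = \<delta> ^ n * psi2 n u"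
proof (induction n)
  case 0
  show ?case by (simp add: psi1_def psi2_def)
next
  case (Suc n)
  let ?f = "\<lambda>k. fst (qw_amp a b c d \<alpha> \<beta> n k)" and ?g = "\<lambda>k. snd (qw_amp a b c d \<alpha> \<beta> n k)"
  let ?A = "{-int n..int n}" and ?B = "{-int (Suc n)..int (Suc n)}"
  have outA: "?f k = 0" "?g k = 0" if "k \<notin> ?A" for k
    using qw_amp_outside[of n k a b c d \<alpha> \<beta>] that by auto
  have shift: "(\<Sum>k\<in>?B. cis (of_int k * (u + \<xi>)) * h (k + s)) =
      cis (- of_int s * (u + \<xi>)) * (\<Sum>k\<in>?A. cis (of_int k * (u + \<xi>)) * h k)"
    if "\<And>k. k \<notin> ?A \<Longrightarrow> h k = 0" "\<bar>s\<bar> = 1" for h s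
  proof (rule trigonometric_sum_shift)
    show "h (k + s) = 0" if "k \<notin> ?B" for k
      by (rule \<open>\<And>k. k \<notin> ?A \<Longrightarrow> h k = 0\<close>) (use that \<open>\<bar>s\<bar> = 1\<close> in auto)
  qed (use that in auto)
  have f1: "(\<Sum>k\<in>?B. cis (of_int k * (u + \<xi>)) * ?f (k + 1)) = cis (- (u + \<xi>)) * (\<delta> ^ n * psi1 n u)"
    and g1: "(\<Sum>k\<in>?B. cis (of_int k * (u + \<xi>)) * ?g (k + 1)) = cis (- (u + \<xi>)) * (\<delta> ^ n * psi2 n u)"
    and f2: "(\<Sum>k\<in>?B. cis (of_int k * (u + \<xi>)) * ?f (k - 1)) = cis (u + \<xi>) * (\<delta> ^ n * psi1 n u)"
    and g2: "(\<Sum>k\<in>?B. cis (of_int k * (u + \<xi>)) * ?g (k - 1)) = cis (u + \<xi>) * (\<delta> ^ n * psi2 n u)"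
    using shift[of ?f 1, OF outA(1)] shift[of ?g 1, OF outA(2)]
      shift[of ?f "-1", OF outA(1)] shift[of ?g "-1", OF outA(2)] Suc.IH
    by (simp_all del: of_nat_Suc)
  have e: "\<delta> * r * cis \<xi> * cis (- (u + \<xi>)) = \<delta> * (r * cis (- u))"
      "\<delta> * q * cis \<xi> * cis (- (u + \<xi>)) = \<delta> * (q * cis (- u))"
      "- \<delta> * cnj q * cis (- \<xi>) * cis (u + \<xi>) = \<delta> * (- cnj q * cis u)"
      "\<delta> * r * cis (- \<xi>) * cis (u + \<xi>) = \<delta> * (r * cis u)"
    by (simp_all add: mult.assoc cis_mult)
  have "(\<Sum>k\<in>?B. cis (of_int k * (u + \<xi>)) * fst (qw_amp a b c d \<alpha> \<beta> (Suc n) k)) =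
      a * (\<Sum>k\<in>?B. cis (of_int k * (u + \<xi>)) * ?f (k + 1)) + b * (\<Sum>k\<in>?B. cis (of_int k * (u + \<xi>)) * ?g (k + 1))"
    unfolding sum_distrib_left sum.distrib[symmetric] by (intro sum.cong refl) (simp add: algebra_simps)
  also have "\<dots> = (a * cis (- (u + \<xi>))) * (\<delta> ^ n * psi1 n u) + (b * cis (- (u + \<xi>))) * (\<delta> ^ n * psi2 n u)"
    unfolding f1 g1 by (simp only: mult.assoc)
  also have "\<dots> = \<delta> ^ Suc n * psi1 (Suc n) u"
    unfolding U e psi_Suc(1)[symmetric] by (simp add: algebra_simps)
  finally have 1: "(\<Sum>k\<in>?B. cis (of_int k * (u + \<xi>)) * fst (qw_amp a b c d \<alpha> \<beta> (Suc n) k)) = \<delta> ^ Suc n * psi1 (Suc n) u" .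
  have "(\<Sum>k\<in>?B. cis (of_int k * (u + \<xi>)) * snd (qw_amp a b c d \<alpha> \<beta> (Suc n) k)) =
      c * (\<Sum>k\<in>?B. cis (of_int k * (u + \<xi>)) * ?f (k - 1)) + d * (\<Sum>k\<in>?B. cis (of_int k * (u + \<xi>)) * ?g (k - 1))"
    unfolding sum_distrib_left sum.distrib[symmetric] by (intro sum.cong refl) (simp add: algebra_simps)
  also have "\<dots> = (c * cis (u + \<xi>)) * (\<delta> ^ n * psi1 n u) + (d * cis (u + \<xi>)) * (\<delta> ^ n * psi2 n u)"
    unfolding f2 g2 by (simp only: mult.assoc)
  also have "\<dots> = \<delta> ^ Suc n * psi2 (Suc n) u"
    unfolding U e psi_Suc(2)[symmetric] by (simp add: algebra_simps)
  finally show ?case using 1 by blast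
qed

text \<open>Parseval for both components. The momentum shift \<open>\<xi>\<close> moves into the
  coefficients as a phase, which does not change their moduli, and \<open>\<delta> ^ n\<close>
  cancels because \<open>\<delta>\<close> has modulus 1.\<close>

lemma has_integral_overlap:
  fixes a b c d \<delta> :: complex and \<xi> :: real and n :: nat
  assumes U: "a = \<delta> * r * cis \<xi>" "b = \<delta> * q * cis \<xi>" "c = - \<delta> * cnj q * cis (- \<xi>)" "d = \<delta> * r * cis (- \<xi>)"
    and \<delta>: "cmod \<delta> = 1"
  shows "((\<lambda>u. overlap n u (u + s)) has_integral
      2 * pi * (\<Sum>k\<in>{-int n..int n}. qw_prob a b c d \<alpha> \<beta> n k * cis (of_int k * s))) {p..p + 2 * pi}"
proof -
  let ?K = "{-int n..int n}"
  define f where "f k = cis (of_int k * \<xi>) * fst (qw_amp a b c d \<alpha> \<beta> n k)" for k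
  define g where "g k = cis (of_int k * \<xi>) * snd (qw_amp a b c d \<alpha> \<beta> n k)" for k
  have F: "(\<Sum>k\<in>?K. cis (of_int k * u) * f k) = \<delta> ^ n * psi1 n u"
    "(\<Sum>k\<in>?K. cis (of_int k * u) * g k) = \<delta> ^ n * psi2 n u" for u
    using qw_amp_fourier[OF U, where n = n and u = u]
    by (simp_all add: f_def g_def distrib_left cis_mult[symmetric] mult.assoc)
  have d1: "cnj \<delta> ^ n * \<delta> ^ n = 1"
    using complex_of_real_cmod_square[of \<delta>] \<delta> by (simp add: power_mult_distrib[symmetric] mult.commute)
  have "((\<lambda>u. cnj (\<Sum>k\<in>?K. cis (of_int k * u) * f k) * (\<Sum>k\<in>?K. cis (of_int k * (u + s)) * f k)
      + cnj (\<Sum>k\<in>?K. cis (of_int k * u) * g k) * (\<Sum>k\<in>?K. cis (of_int k * (u + s)) * g k)) has_integral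
      2 * pi * (\<Sum>k\<in>?K. (cmod (f k))\<^sup>2 * cis (of_int k * s)) + 2 * pi * (\<Sum>k\<in>?K. (cmod (g k))\<^sup>2 * cis (of_int k * s)))
      {p..p + 2 * pi}"
    by (intro has_integral_add parseval_trigonometric_polynomial) auto
  also have "(\<lambda>u. cnj (\<Sum>k\<in>?K. cis (of_int k * u) * f k) * (\<Sum>k\<in>?K. cis (of_int k * (u + s)) * f k)
      + cnj (\<Sum>k\<in>?K. cis (of_int k * u) * g k) * (\<Sum>k\<in>?K. cis (of_int k * (u + s)) * g k))
      = (\<lambda>u. overlap n u (u + s))"
  proof
    fix u
    have "cnj (\<delta> ^ n * x) * (\<delta> ^ n * y) = cnj x * y" for x y
    proof -
      have "cnj (\<delta> ^ n * x) * (\<delta> ^ n * y) = (cnj \<delta> ^ n * \<delta> ^ n) * (cnj x * y)" by (simp add: mult_ac)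
      then show ?thesis by (simp add: d1)
    qed
    then show "cnj (\<Sum>k\<in>?K. cis (of_int k * u) * f k) * (\<Sum>k\<in>?K. cis (of_int k * (u + s)) * f k)
      + cnj (\<Sum>k\<in>?K. cis (of_int k * u) * g k) * (\<Sum>k\<in>?K. cis (of_int k * (u + s)) * g k) = overlap n u (u + s)"
      unfolding F overlap_def by (simp only:)
  qed
  also have "2 * pi * (\<Sum>k\<in>?K. (cmod (f k))\<^sup>2 * cis (of_int k * s)) + 2 * pi * (\<Sum>k\<in>?K. (cmod (g k))\<^sup>2 * cis (of_int k * s))
      = 2 * pi * (\<Sum>k\<in>?K. qw_prob a b c d \<alpha> \<beta> n k * cis (of_int k * s))"
    unfolding distrib_left[symmetric] sum.distrib[symmetric]
    by (simp add: f_def g_def qw_prob_def norm_mult distrib_right)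
  finally show ?thesis .
qed

section \<open>Limit of the characteristic functions and comparison with the density\<close>

lemma cont_overlap: "continuous_on UNIV (\<lambda>u. overlap n u (u + s))"
  unfolding overlap_def
  by (intro continuous_intros cont_psi continuous_on_compose2[OF cont_psi(1)] continuous_on_compose2[OF cont_psi(2)]) auto

definition limit_integrand :: "real \<Rightarrow> real \<Rightarrow> complex" where
  "limit_integrand t u = rcos (t * group_velocity r u) + \<i> * skew u * rsin (t * group_velocity r u)"

lemma integral_overlap_limit:
  "(\<lambda>n. integral {p..p'} (\<lambda>u. overlap n u (u + t / real n))) \<longlonglongrightarrow> integral {p..p'} (limit_integrand t)"
proof (rule dominated_convergence(2)[where h = "\<lambda>_. 2"])
  show "(\<lambda>u. overlap n u (u + t / real n)) integrable_on {p..p'}" for n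
    by (intro integrable_continuous_real continuous_on_subset[OF cont_overlap]) auto
  show "(\<lambda>n. overlap n u (u + t / real n)) \<longlonglongrightarrow> limit_integrand t u" for u
    unfolding limit_integrand_def by (rule overlap_limit)
qed (auto simp: norm_overlap integrable_const_ivl)

lemma cont_limit_integrand: "continuous_on UNIV (limit_integrand t)"
  unfolding limit_integrand_def by (intro continuous_intros continuous_on_group_velocity[OF r] cont_skew)

text \<open>
  The reflection \<open>u \<mapsto> pi - u\<close> fixes \<open>group_velocity\<close> and changes the sign of the cosine term of \<open>skew\<close>;
  what remains is completed to the exponential by a term that is odd in \<open>u\<close>.
\<close>

lemma integral_limit_integrand:
  "integral {-(pi/2)..3*pi/2} (limit_integrand t) =
     2 * integral {-(pi/2)..pi/2} (\<lambda>u. (1 - coef * group_velocity r u) * cis (t * group_velocity r u))"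
proof -
  let ?I = "{-(pi/2)..pi/2}" and ?G = "limit_integrand t"
  define f where "f u = (1 - coef * group_velocity r u) * cis (t * group_velocity r u)" for u
  \<comment> \<open>Chosen so that, with h the group velocity, \<open>f u - odd_part u\<close>
    equals \<open>cos (t * h) - \<i> * coef * h * sin (t * h)\<close>, half of the symmetrized
    integrand.\<close>
  define odd_part where "odd_part u = \<i> * rsin (t * group_velocity r u) - coef * group_velocity r u * rcos (t * group_velocity r u)" for u
  have int: "h integrable_on {x..y}" if "continuous_on UNIV h" for h :: "real \<Rightarrow> complex" and x y :: real
    by (intro integrable_continuous_real continuous_on_subset[OF that]) auto
  have refl: "((\<lambda>u. ?G (pi - u)) has_integral integral {pi/2..3*pi/2} ?G) ?I"
  proof -
    have "((\<lambda>u. (-1) *\<^sub>R ?G (pi - u)) has_integral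
        integral {pi - (-(pi/2))..pi - pi/2} ?G - integral {pi - pi/2..pi - (-(pi/2))} ?G) ?I"
    proof (rule has_integral_substitution_general[where s = "{}" and c = "pi/2" and d = "3*pi/2"])
      show "continuous_on {pi/2..3*pi/2} ?G" by (rule continuous_on_subset[OF cont_limit_integrand]) simp
      show "((-) pi has_real_derivative -1) (at x within ?I)" for x
        by (auto intro!: derivative_eq_intros)
    qed (auto intro!: continuous_intros)
    from has_integral_neg[OF this] show ?thesis by simp
  qed
  have "integral {-(pi/2)..3*pi/2} ?G = integral ?I ?G + integral {pi/2..3*pi/2} ?G"
    by (rule Henstock_Kurzweil_Integration.integral_combine[symmetric]) (auto intro: int cont_limit_integrand)
  also have "\<dots> = integral ?I (\<lambda>u. ?G u + ?G (pi - u))"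
    using refl has_integral_integrable[OF refl] int[OF cont_limit_integrand]
    by (subst Henstock_Kurzweil_Integration.integral_add) (auto dest: integral_unique)
  also have "(\<lambda>u. ?G u + ?G (pi - u)) = (\<lambda>u. 2 * (f u - odd_part u))"
  proof
    fix u
    have s: "sin_ang (pi - u) = sin_ang u" by (simp add: sin_ang_def)
    have v: "group_velocity r (pi - u) = group_velocity r u"
      by (simp add: group_velocity_def)
    have k: "skew u + skew (pi - u) = - 2 * coef * group_velocity r u"
      by (simp add: skew_def v s)
    have "?G u + ?G (pi - u) = 2 * rcos (t * group_velocity r u)
        + \<i> * complex_of_real (skew u + skew (pi - u)) * rsin (t * group_velocity r u)"
      by (simp add: limit_integrand_def v algebra_simps)
    also have "\<dots> = 2 * (f u - odd_part u)"
      unfolding k f_def odd_part_def cis_conv_exp exp_Euler cos_of_real sin_of_real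
      by (simp add: algebra_simps)
    finally show "?G u + ?G (pi - u) = 2 * (f u - odd_part u)" .
  qed
  also have "integral ?I (\<lambda>u. 2 * (f u - odd_part u)) = 2 * (integral ?I f - integral ?I odd_part)"
  proof -
    have "continuous_on UNIV f" "continuous_on UNIV odd_part"
      unfolding f_def odd_part_def by (intro continuous_intros continuous_on_group_velocity[OF r])+
    then show ?thesis by (simp add: Henstock_Kurzweil_Integration.integral_diff int)
  qed
  also have "integral ?I odd_part = 0"
  proof -
    have "integral {-(pi/2)..-(-(pi/2))} (\<lambda>u. odd_part (- u)) = integral ?I odd_part"
      by (rule Henstock_Kurzweil_Integration.integral_reflect_real)
    moreover have "odd_part (- u) = - odd_part u" for u
      by (simp add: odd_part_def group_velocity_def)
    ultimately show ?thesis by simp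
  qed
  finally show ?thesis by (simp add: f_def)
qed

lemma qw_characteristic_limit:
  fixes a b c d \<delta> :: complex and \<xi> t :: real
  assumes U: "a = \<delta> * r * cis \<xi>" "b = \<delta> * q * cis \<xi>" "c = - \<delta> * cnj q * cis (- \<xi>)" "d = \<delta> * r * cis (- \<xi>)"
    and \<delta>: "cmod \<delta> = 1"
  shows "(\<lambda>n. \<Sum>k\<in>{-int n..int n}. qw_prob a b c d \<alpha> \<beta> n k * cis (of_int k * (t / real n))) \<longlonglongrightarrow>
     integral {-(pi/2)..pi/2} (\<lambda>u. (1 - coef * group_velocity r u) * cis (t * group_velocity r u)) / pi"
proof -
  \<comment> \<open>A period starting at \<open>-(pi/2)\<close> splits into two halves exchanged by
    the reflection. The factor 2 from folding them turns the mean over \<open>2 * pi\<close> into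
    division by \<open>pi\<close>.\<close>
  have p: "-(pi/2) + 2 * pi = 3*pi/2" by simp
  have "(\<Sum>k\<in>{-int n..int n}. qw_prob a b c d \<alpha> \<beta> n k * cis (of_int k * (t / real n)))
      = integral {-(pi/2)..3*pi/2} (\<lambda>u. overlap n u (u + t / real n)) / (2 * pi)" for n
    using integral_unique[OF has_integral_overlap[OF U \<delta>, of n "t / real n" "-(pi/2)"]] unfolding p by simp
  moreover have "(\<lambda>n. integral {-(pi/2)..3*pi/2} (\<lambda>u. overlap n u (u + t / real n)) / (2 * pi)) \<longlonglongrightarrow>
     integral {-(pi/2)..3*pi/2} (limit_integrand t) / (2 * pi)"
    by (intro tendsto_divide integral_overlap_limit tendsto_const) simp
  ultimately show ?thesis by (simp add: integral_limit_integrand)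
qed

text \<open>The case of shift 0 in \<open>has_integral_overlap\<close>, where the integrand is
  1.\<close>

lemma sum_qw_prob:
  fixes a b c d \<delta> :: complex and \<xi> :: real and n :: nat
  assumes U: "a = \<delta> * r * cis \<xi>" "b = \<delta> * q * cis \<xi>" "c = - \<delta> * cnj q * cis (- \<xi>)" "d = \<delta> * r * cis (- \<xi>)"
    and \<delta>: "cmod \<delta> = 1"
  shows "(\<Sum>k\<in>{-int n..int n}. qw_prob a b c d \<alpha> \<beta> n k) = 1"
proof -
  have "((\<lambda>u::real. 1) has_integral complex_of_real (2 * pi)) {0..0 + 2 * pi}"
    using has_integral_const_real[of "1::complex" 0 "2 * pi"] by (simp add: scaleR_conv_of_real)
  from has_integral_unique[OF has_integral_overlap[OF U \<delta>, of n 0 0, simplified add_0_right overlap_self] this]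
  have "complex_of_real (\<Sum>k\<in>{-int n..int n}. qw_prob a b c d \<alpha> \<beta> n k) = 1" by simp
  then show ?thesis by (simp only: of_real_eq_1_iff)
qed

text \<open>
  At \<open>u = pi / 2\<close> the cosine term of \<open>skew\<close> vanishes, so Cauchy-Schwarz for the two unit vectors
  \<open>(\<alpha>, \<beta>)\<close> and \<open>(v1 u, v2 u)\<close> gives the bound.
\<close>

lemma abs_coef_le: "\<bar>coef\<bar> * r \<le> 1"
proof -
  let ?u = "pi / 2"
  have am: "2 * (x * y) \<le> x\<^sup>2 + y\<^sup>2" for x y :: real
    using zero_le_power2[of "x - y"] by (simp add: power2_diff)
  have n: "(cmod (v1 ?u))\<^sup>2 + (cmod (v2 ?u))\<^sup>2 = 1"
  proof -
    have "complex_of_real ((cmod (v1 ?u))\<^sup>2 + (cmod (v2 ?u))\<^sup>2) = 1"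
      unfolding of_real_add of_real_power complex_of_real_cmod_square using v_norm[of ?u] by (simp add: mult.commute)
    then show ?thesis by (simp only: of_real_eq_1_iff)
  qed
  have "\<bar>skew ?u\<bar> = cmod (cnj \<alpha> * v1 ?u + cnj \<beta> * v2 ?u)"
    unfolding state_v by (simp add: norm_mult)
  also have "\<dots> \<le> cmod \<alpha> * cmod (v1 ?u) + cmod \<beta> * cmod (v2 ?u)"
    by (rule order_trans[OF norm_triangle_ineq]) (simp add: norm_mult)
  also have "\<dots> \<le> 1"
    using am[of "cmod \<alpha>" "cmod (v1 ?u)"] am[of "cmod \<beta>" "cmod (v2 ?u)"] n state by linarith
  finally show ?thesis using r by (simp add: skew_def group_velocity_def abs_mult)
qed

text \<open>The integrand is complex, so integrability comes from boundedness on the support instead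
  of from nonnegativity; uniqueness of the gauge integral then identifies the value with the one
  given by the substitution.\<close>

lemma konno_integral:
  "integral\<^sup>L lborel (\<lambda>x. konno_pdf r x *\<^sub>R ((1 - coef * x) * cis (t * x))) =
    integral {-(pi/2)..pi/2} (\<lambda>u. (1 - coef * group_velocity r u) * cis (t * group_velocity r u)) / pi"
proof -
  define H where "H x = complex_of_real (1 - coef * x) * cis (t * x)" for x
  have cH: "continuous_on UNIV H" unfolding H_def by (intro continuous_intros)
  have [measurable]: "H \<in> borel_measurable borel" using cH by (rule borel_measurable_continuous_onI)
  let ?J = "integral {-(pi/2)..pi/2} (\<lambda>u. H (group_velocity r u))"
  have "norm (H x) \<le> 2" if "\<bar>x\<bar> < r" for x
  proof -
    have "\<bar>coef * x\<bar> \<le> \<bar>coef\<bar> * r" unfolding abs_mult using that by (intro mult_left_mono) auto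
    then have "\<bar>1 - coef * x\<bar> \<le> 2" using abs_coef_le by linarith
    then show ?thesis unfolding H_def norm_mult norm_of_real by simp
  qed
  then have i: "integrable lborel (\<lambda>x. konno_pdf r x *\<^sub>R H x)"
    by (intro integrable_konno_pdf_bounded[OF r]) auto
  have eq: "konno_pdf r x *\<^sub>R H x = (1/pi) *\<^sub>R ((pi * konno_density r x) *\<^sub>R H x)" if "x \<in> {-r..r} - {-r,r}" for x
    using that by (auto simp: konno_pdf_def indicator_def)
  have "((\<lambda>x. konno_pdf r x *\<^sub>R H x) has_integral (1/pi) *\<^sub>R ?J) {-r..r}"
    by (rule has_integral_spike_finite[OF _ _ has_integral_cmul[OF has_integral_konno_density[OF r cH]], of "{-r,r}"])
      (use eq in auto)
  then have "((\<lambda>x. konno_pdf r x *\<^sub>R H x) has_integral (1/pi) *\<^sub>R ?J) UNIV"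
    by (rule has_integral_on_superset) (auto simp: konno_pdf_def indicator_def)
  from has_integral_unique[OF this has_integral_integral_lborel[OF i]]
  show ?thesis by (simp add: H_def scaleR_conv_of_real)
qed

end

section \<open>Splitting a unitary matrix into a phase, a momentum shift and a normalized
  coin\<close>

lemma unitary2_factorization:
  fixes a b c d :: complex
  assumes U: "unitary2 a b c d" and nz: "a * b * c * d \<noteq> 0"
  obtains \<delta> :: complex and \<xi> :: real where "cmod \<delta> = 1"
    "a = \<delta> * cmod a * cis \<xi>" "b = \<delta> * (cmod a * b / a) * cis \<xi>"
    "c = - \<delta> * cnj (cmod a * b / a) * cis (- \<xi>)" "d = \<delta> * cmod a * cis (- \<xi>)"
    "(cmod a)\<^sup>2 + (cmod b)\<^sup>2 = 1"
proof -
  have u: "cnj a * a + cnj c * c = 1" "cnj b * b + cnj d * d = 1" "cnj a * b + cnj c * d = 0"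
    using U by (auto simp: unitary2_def)
  have nz: "a \<noteq> 0" "b \<noteq> 0" using nz by auto
  \<comment> \<open>The determinant. The inverse of a unitary matrix is its adjoint, so Cramer's
    rule expresses the entries through conjugates and \<open>D\<close>.\<close>
  define D where "D = a * d - b * c"
  have b: "b = - (D * cnj c)" and d: "d = D * cnj a"
    unfolding D_def using u by algebra+
  have "cnj b * b + cnj d * d = (cnj D * D) * (cnj a * a + cnj c * c)"
    by (simp add: b d algebra_simps)
  then have D1: "D * cnj D = 1" using u by (simp add: mult.commute)
  then have c: "c = - (D * cnj b)" by (simp add: b mult.assoc[symmetric])
  have "complex_of_real ((cmod D)\<^sup>2) = 1" by (simp add: complex_of_real_cmod_square D1)
  then have "(cmod D)\<^sup>2 = 1" by (simp only: of_real_eq_1_iff)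
  then have "cmod D = 1" using norm_ge_zero[of D] by (auto simp: power2_eq_1_iff)
  \<comment> \<open>Dividing the matrix by a square root of its determinant gives determinant
    1.\<close>
  define \<delta> where "\<delta> = csqrt D"
  have \<delta>2: "\<delta> * \<delta> = D" by (simp add: \<delta>_def flip: power2_eq_square)
  have \<delta>1: "cmod \<delta> = 1"
  proof -
    have "cmod \<delta> * cmod \<delta> = 1" using \<open>cmod D = 1\<close> by (simp flip: norm_mult add: \<delta>2)
    then show ?thesis using norm_ge_zero[of \<delta>] by (simp add: square_eq_1_iff)
  qed
  have \<delta>c: "\<delta> * cnj \<delta> = 1" using complex_of_real_cmod_square[of \<delta>] \<delta>1 by simp
  have \<delta>0: "\<delta> \<noteq> 0" using \<delta>1 by auto
  \<comment> \<open>The phase of the upper left entry after this division; it becomes the momentum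
    shift.\<close>
  define \<xi> where "\<xi> = Arg (a / \<delta>)"
  have x: "cmod a * cis \<xi> = a / \<delta>"
    using cis_Arg[of "a / \<delta>"] nz \<delta>0 \<delta>1 by (simp add: \<xi>_def sgn_div_norm norm_divide scaleR_conv_of_real field_simps)
  have xc: "cmod a * cis (- \<xi>) = cnj a * \<delta>"
  proof -
    have "cmod a * cis (- \<xi>) = cnj (cmod a * cis \<xi>)" by (simp add: cis_cnj)
    also have "\<dots> = cnj a / cnj \<delta>" by (simp add: x)
    also have "\<dots> = cnj a * \<delta>" using \<delta>c \<delta>0 by (simp add: divide_eq_eq mult.assoc)
    finally show ?thesis .
  qed
  show thesis
  proof (rule that[of \<delta> \<xi>])
    show "cmod \<delta> = 1" by fact
    show "a = \<delta> * cmod a * cis \<xi>" using x \<delta>0 by (simp add: mult.assoc)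
    have "\<delta> * (cmod a * b / a) * cis \<xi> = \<delta> * b / a * (cmod a * cis \<xi>)" by (simp add: field_simps)
    also have "\<dots> = b" unfolding x using nz \<delta>0 by simp
    finally show "b = \<delta> * (cmod a * b / a) * cis \<xi>" ..
    have "- \<delta> * cnj (cmod a * b / a) * cis (- \<xi>) = - \<delta> * cnj b / cnj a * (cmod a * cis (- \<xi>))"
      by (simp add: field_simps)
    also have "\<dots> = c" unfolding xc c \<delta>2[symmetric] using nz by simp
    finally show "c = - \<delta> * cnj (cmod a * b / a) * cis (- \<xi>)" ..
    show "d = \<delta> * cmod a * cis (- \<xi>)"
      unfolding mult.assoc xc d \<delta>2[symmetric] by (simp add: mult_ac)
    have "complex_of_real ((cmod a)\<^sup>2 + (cmod b)\<^sup>2) = a * cnj a + b * cnj b"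
      by (simp add: complex_of_real_cmod_square)
    also have "b * cnj b = (D * cnj D) * (cnj c * c)" by (simp add: b mult_ac)
    also have "a * cnj a + \<dots> = 1" using u(1) by (simp add: D1 mult.commute)
    finally show "(cmod a)\<^sup>2 + (cmod b)\<^sup>2 = 1" by (simp only: of_real_eq_1_iff)
  qed
qed

section \<open>Finitely supported laws and the conclusion by characteristic functions\<close>

lemma prob_space_density_count_space:
  fixes p :: "'a \<Rightarrow> real"
  assumes K: "finite K" and p0: "\<And>k. 0 \<le> p k" and out: "\<And>k. k \<notin> K \<Longrightarrow> p k = 0" and one: "sum p K = 1"
  shows "prob_space (density (count_space UNIV) (\<lambda>k. ennreal (p k)))"
proof
  have "(\<integral>\<^sup>+k. ennreal (p k) \<partial>count_space UNIV) = (\<Sum>k\<in>K. ennreal (p k))"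
    by (rule nn_integral_count_space'[OF K]) (auto simp: out)
  also have "\<dots> = 1" using one p0 by (simp add: sum_ennreal)
  finally show "emeasure (density (count_space UNIV) (\<lambda>k. ennreal (p k)))
      (space (density (count_space UNIV) (\<lambda>k. ennreal (p k)))) = 1"
    by (simp add: emeasure_density)
qed

lemma char_distr_density_count_space:
  fixes p :: "'a \<Rightarrow> real"
  assumes K: "finite K" and p0: "\<And>k. 0 \<le> p k" and out: "\<And>k. k \<notin> K \<Longrightarrow> p k = 0"
  shows "char (distr (density (count_space UNIV) (\<lambda>k. ennreal (p k))) borel X) t = (\<Sum>k\<in>K. p k * cis (t * X k))"
proof -
  have "char (distr (density (count_space UNIV) (\<lambda>k. ennreal (p k))) borel X) t
      = (\<integral>k. iexp (t * X k) \<partial>density (count_space UNIV) (\<lambda>k. ennreal (p k)))"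
    unfolding char_def by (rule integral_distr) simp_all
  also have "\<dots> = (\<integral>k. p k *\<^sub>R iexp (t * X k) \<partial>count_space UNIV)"
    by (rule integral_density) (simp_all add: p0)
  also have "\<dots> = (\<Sum>k | k \<in> UNIV \<and> p k *\<^sub>R iexp (t * X k) \<noteq> 0. p k *\<^sub>R iexp (t * X k))"
    by (rule lebesgue_integral_count_space_finite_support) (rule finite_subset[OF _ K], use out in auto)
  also have "\<dots> = (\<Sum>k\<in>K. p k * cis (t * X k))"
    by (rule sum.mono_neutral_cong_left) (use K out in \<open>auto simp: cis_conv_exp scaleR_conv_of_real\<close>)
  finally show ?thesis .
qed

theorem theorem3:
  fixes a b c d \<alpha> \<beta> :: complex
  assumes "unitary2 a b c d"
    and "a * b * c * d \<noteq> 0"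
    and "(cmod \<alpha>)\<^sup>2 + (cmod \<beta>)\<^sup>2 = 1"
  shows "prob_space (density lborel (\<lambda>x. ennreal (qw_density a b \<alpha> \<beta> x)))
    \<and> weak_conv_m (qw_scaled_law a b c d \<alpha> \<beta>) (density lborel (\<lambda>x. ennreal (qw_density a b \<alpha> \<beta> x)))
    \<and> has_bochner_integral lborel (\<lambda>x. x * qw_density a b \<alpha> \<beta> x)
        (- qw_coef a b \<alpha> \<beta> * (1 - sqrt (1 - (cmod a)\<^sup>2)))
    \<and> has_bochner_integral lborel (\<lambda>x. x\<^sup>2 * qw_density a b \<alpha> \<beta> x)
        (1 - sqrt (1 - (cmod a)\<^sup>2))"
proof -
  obtain \<delta> :: complex and \<xi> :: real where \<delta>: "cmod \<delta> = 1" and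
    U: "a = \<delta> * cmod a * cis \<xi>" "b = \<delta> * (cmod a * b / a) * cis \<xi>"
      "c = - \<delta> * cnj (cmod a * b / a) * cis (- \<xi>)" "d = \<delta> * cmod a * cis (- \<xi>)"
    and ab: "(cmod a)\<^sup>2 + (cmod b)\<^sup>2 = 1"
    by (rule unitary2_factorization[OF assms(1,2)])
  define q where "q = complex_of_real (cmod a) * b / a"
  note U = U[folded q_def]
  have nz: "a \<noteq> 0" "b \<noteq> 0" using assms(2) by auto
  have r: "0 < cmod a" "cmod a < 1"
  proof -
    show "0 < cmod a" using nz by simp
    have "0 < (cmod b)\<^sup>2" using nz by simp
    then have "(cmod a)\<^sup>2 < 1" using ab by linarith
    then show "cmod a < 1" by (simp add: abs_square_less_1)
  qed
  interpret coin "cmod a" q \<alpha> \<beta>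
    using r ab assms(3) nz by unfold_locales (simp_all add: q_def norm_mult norm_divide)
  have coef: "qw_coef a b \<alpha> \<beta> = coef"
  proof -
    let ?z = "cnj (a * \<alpha>) * b * \<beta>"
    have a2: "complex_of_real ((cmod a)\<^sup>2) = a * cnj a" by (simp add: complex_of_real_cmod_square)
    have "cnj \<alpha> * \<beta> * q / cmod a = cnj \<alpha> * \<beta> * b / a" using nz by (simp add: q_def)
    also have "\<dots> = ?z / complex_of_real ((cmod a)\<^sup>2)" unfolding a2 using nz by (simp add: field_simps)
    finally have 1: "Re (cnj \<alpha> * \<beta> * q) / cmod a = Re ?z / (cmod a)\<^sup>2"
      by (metis Re_divide_of_real)
    \<comment> \<open>The two summands are conjugate to each other, hence twice a real part.\<close>
    have "a * \<alpha> * cnj (b * \<beta>) + cnj (a * \<alpha>) * b * \<beta> = complex_of_real (2 * Re ?z)"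
      using complex_add_cnj[of ?z] by (simp add: mult_ac add.commute)
    then show ?thesis unfolding qw_coef_def coef_def using 1 by (simp only: Re_divide_of_real Re_complex_of_real times_divide_eq_right[symmetric])
  qed
  have dens: "qw_density a b \<alpha> \<beta> x = konno_pdf (cmod a) x * (1 - coef * x)" for x
    by (simp add: qw_density_def konno_pdf_def konno_density_def coef indicator_def)
  have dens0: "0 \<le> qw_density a b \<alpha> \<beta> x" for x
  proof (cases "\<bar>x\<bar> < cmod a")
    case True
    then have "\<bar>coef * x\<bar> \<le> \<bar>coef\<bar> * cmod a" unfolding abs_mult by (intro mult_left_mono) auto
    \<comment> \<open>The bound \<open>abs_coef_le\<close> makes the linear factor nonnegative on
      the whole support.\<close>
    then have "coef * x \<le> 1" using abs_coef_le by linarith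
    then show ?thesis unfolding dens by (simp add: konno_pdf_nonneg[OF r])
  qed (auto simp: qw_density_def)
  have densM [measurable]: "qw_density a b \<alpha> \<beta> \<in> borel_measurable borel"
    unfolding dens[abs_def] by measurable
  let ?M = "density lborel (\<lambda>x. ennreal (qw_density a b \<alpha> \<beta> x))"
  \<comment> \<open>The factor \<open>1 - coef * x\<close> expresses each of the three integrals by
    two consecutive moments of the symmetric density, one of which is odd and vanishes.\<close>
  note m0 = has_bochner_integral_konno_pdf[OF r] and m2 = has_bochner_integral_konno_pdf_square[OF r]
    and m1 = has_bochner_integral_konno_pdf_odd[OF r, of 1, simplified]
    and m3 = has_bochner_integral_konno_pdf_odd[OF r, of 3, simplified]
  have I0: "has_bochner_integral lborel (qw_density a b \<alpha> \<beta>) 1"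
    using has_bochner_integral_diff[OF m0 has_bochner_integral_mult_right[OF m1, of coef]]
    by (simp add: dens[abs_def] algebra_simps)
  have I1: "has_bochner_integral lborel (\<lambda>x. x * qw_density a b \<alpha> \<beta> x)
      (- qw_coef a b \<alpha> \<beta> * (1 - sqrt (1 - (cmod a)\<^sup>2)))"
    using has_bochner_integral_diff[OF m1 has_bochner_integral_mult_right[OF m2, of coef]]
    by (simp add: dens[abs_def] coef algebra_simps power2_eq_square)
  have I2: "has_bochner_integral lborel (\<lambda>x. x\<^sup>2 * qw_density a b \<alpha> \<beta> x) (1 - sqrt (1 - (cmod a)\<^sup>2))"
    using has_bochner_integral_diff[OF m2 has_bochner_integral_mult_right[OF m3, of coef]]
    by (simp add: dens[abs_def] algebra_simps power2_eq_square power3_eq_cube)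
  have P: "prob_space ?M"
  proof
    have "(\<integral>\<^sup>+x. ennreal (qw_density a b \<alpha> \<beta> x) \<partial>lborel) = ennreal 1"
      using I0 dens0 by (subst nn_integral_eq_integral) (auto simp: has_bochner_integral_iff)
    then show "emeasure ?M (space ?M) = 1" by (simp add: emeasure_density)
  qed
  have W: "weak_conv_m (qw_scaled_law a b c d \<alpha> \<beta>) ?M"
  proof (rule levy_continuity)
    have out: "qw_prob a b c d \<alpha> \<beta> n k = 0" if "k \<notin> {-int n..int n}" for n k
      using that by (intro qw_prob_outside) auto
    have p0: "0 \<le> qw_prob a b c d \<alpha> \<beta> n k" for n k by (simp add: qw_prob_def)
    show "real_distribution (qw_scaled_law a b c d \<alpha> \<beta> n)" for n
    proof -
      interpret prob_space "density (count_space UNIV) (\<lambda>k. ennreal (qw_prob a b c d \<alpha> \<beta> n k))"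
        by (rule prob_space_density_count_space[where K = "{-int n..int n}"])
          (use p0 out sum_qw_prob[OF U \<delta>] in auto)
      show ?thesis unfolding qw_scaled_law_def by (rule real_distribution_distr) simp
    qed
    show "real_distribution ?M"
      using P by (simp add: real_distribution_def real_distribution_axioms_def)
    fix t
    \<comment> \<open>This includes \<open>n = 0\<close>: division by zero gives 0 on both
      sides.\<close>
    have "char (qw_scaled_law a b c d \<alpha> \<beta> n) t =
        (\<Sum>k\<in>{-int n..int n}. qw_prob a b c d \<alpha> \<beta> n k * cis (of_int k * (t / real n)))" for n
      unfolding qw_scaled_law_def
      by (subst char_distr_density_count_space[where K = "{-int n..int n}"])
        (use p0 out in \<open>auto simp: mult.commute\<close>)
    moreover have "char ?M t = integral {-(pi/2)..pi/2}
        (\<lambda>u. (1 - coef * group_velocity (cmod a) u) * cis (t * group_velocity (cmod a) u)) / pi"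
    proof -
      have "char ?M t = (\<integral>x. qw_density a b \<alpha> \<beta> x *\<^sub>R iexp (t * x) \<partial>lborel)"
        unfolding char_def by (rule integral_density) (simp_all add: dens0)
      also have "\<dots> = (\<integral>x. konno_pdf (cmod a) x *\<^sub>R ((1 - coef * x) * cis (t * x)) \<partial>lborel)"
        by (intro Bochner_Integration.integral_cong refl) (simp add: dens cis_conv_exp scaleR_conv_of_real)
      finally show ?thesis by (simp only: konno_integral)
    qed
    ultimately show "(\<lambda>n. char (qw_scaled_law a b c d \<alpha> \<beta> n) t) \<longlonglongrightarrow> char ?M t"
      using qw_characteristic_limit[OF U \<delta>, of t] by simp
  qed
  show ?thesis using P W I1 I2 by blast
qed

end
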